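(* Let $i,j\in\{+,-\}$ and let $u=(u^{(0,0)},u^{(1,0)},u^{(0,1)})^T\in\mathbb{R}^3$ with $u^{(0,0)}\ne 0$; write $u^{|1|}=(u^{(1,0)},u^{(0,1)})^T$. Then there exists a non-negative measure $\psi$ on $\mathcal S_{ij}$ which realizes $u$ with respect to the first-order quarter-moment basis, i.e. such that $$u^{(0,0)}=\int_{\mathcal S_{ij}}\psi\,d\Omega,\qquad u^{|1|}=\int_{\mathcal S_{ij}}\Omega\,\psi\,d\Omega,$$ if and only if $$\|u^{|1|}\|_2\le u^{(0,0)}$$ and the normalized first moment $\phi^{|1|}:=u^{|1|}/u^{(0,0)}$ satisfies $\phi^{|1|}\in\mathcal S_{ij}$.
   Context: Points of the unit sphere $S^2\subset\mathbb{R}^3$ are parametrized by $\mu\in[-1,1]$ (cosine of the polar angle) and the azimuthal angle $\varphi$. By symmetry in the $z$-direction only the first two components are used: $\Omega=(\Omega_x,\Omega_y)^T=(\sqrt{1-\mu^2}\cos\varphi,\sqrt{1-\mu^2}\sin\varphi)^T$, so $\|\Omega\|_2\le 1$. The quarter-spaces are the sets of all $\Omega$ with $\mu\in[-1,1]$ and $\varphi\in[0,\pi/2]$ for $\mathcal S_{++}$, $\varphi\in[\pi/2,\pi]$ for $\mathcal S_{-+}$, $\varphi\in[\pi,3\pi/2]$ for $\mathcal S_{--}$, $\varphi\in[3\pi/2,2\pi]$ for $\mathcal S_{+-}$. Viewed as a set of vectors in $\mathbb{R}^2$, $\mathcal S_{ij}$ is the closed quarter of the unit disk $\{(x,y):x^2+y^2\le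 1,\ ix\ge 0,\ jy\ge 0\}$; membership $\phi^{|1|}\in\mathcal S_{ij}$ is understood in this sense. The first-order quarter-moment basis on $\mathcal S_{ij}$ is $1_{\mathcal S_{ij}}\cdot(1,\Omega_x,\Omega_y)^T$. Measures are finite and non-negative (Dirac masses are allowed, including on the boundary of $\mathcal S_{ij}$, where they count with full mass). *)

theory Defs
  imports "HOL-Analysis.Analysis"
begin

datatype qsign = Pos | Neg

fun sign_val :: "qsign \<Rightarrow> real" where
  "sign_val Pos = 1"
| "sign_val Neg = - 1"

fun azimuth_range :: "qsign \<Rightarrow> qsign \<Rightarrow> real set" where
  "azimuth_range Pos Pos = {0..pi/2}"
| "azimuth_range Neg Pos = {pi/2..pi}"
| "azimuth_range Neg Neg = {pi..3*pi/2}"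
| "azimuth_range Pos Neg = {3*pi/2..2*pi}"

definition sphere_point :: "real \<Rightarrow> real \<Rightarrow> real^3" where
  "sphere_point \<mu> \<phi> = vector [sqrt (1 - \<mu>\<^sup>2) * cos \<phi>, sqrt (1 - \<mu>\<^sup>2) * sin \<phi>, \<mu>]"

definition quarter_sphere :: "qsign \<Rightarrow> qsign \<Rightarrow> (real^3) set" where
  "quarter_sphere i j = {sphere_point \<mu> \<phi> |\<mu> \<phi>. \<mu> \<in> {-1..1} \<and> \<phi> \<in> azimuth_range i j}"

definition Omega :: "real^3 \<Rightarrow> real^2" where
  "Omega p = vector [p $ 1, p $ 2]"

text \<open>The quarter-space viewed as a set of vectors in the plane; it is the image of
  \<^const>\<open>quarter_sphere\<close> under \<^const>\<open>Omega\<close>, see \<open>Omega_image_quarter_sphere\<close> below.\<close>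

definition quarter_disc :: "qsign \<Rightarrow> qsign \<Rightarrow> (real^2) set" where
  "quarter_disc i j =
     {v. (v $ 1)\<^sup>2 + (v $ 2)\<^sup>2 \<le> 1 \<and> sign_val i * v $ 1 \<ge> 0 \<and> sign_val j * v $ 2 \<ge> 0}"

text \<open>Finite non-negative Borel measures whose underlying space is \<open>S\<close> itself. The equation
  between the \<open>\<sigma>\<close>-algebras also forces \<open>space M = S\<close>.\<close>

definition finite_measures_on :: "(real^3) set \<Rightarrow> (real^3) measure set" where
  "finite_measures_on S = {M. finite_measure M \<and> sets M = sets (restrict_space borel S)}"

text \<open>A moment vector is \<open>u = (u $ 1, u $ 2, u $ 3)\<close> with \<open>u $ 1\<close> the zeroth moment
  and \<open>(u $ 2, u $ 3)\<close> the first moment.\<close>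

definition first_moment :: "real^3 \<Rightarrow> real^2" where
  "first_moment u = vector [u $ 2, u $ 3]"

text \<open>The set integrals supply the factor \<open>indicator (quarter_sphere i j)\<close> of the
  first-order quarter-moment basis.\<close>

definition realizes :: "qsign \<Rightarrow> qsign \<Rightarrow> (real^3) measure \<Rightarrow> real^3 \<Rightarrow> bool" where
  "realizes i j \<psi> u \<longleftrightarrow>
     u $ 1 = (LINT p:quarter_sphere i j|\<psi>. 1) \<and>
     first_moment u = (LINT p:quarter_sphere i j|\<psi>. Omega p)"

lemma azimuth_polar:
  assumes "sign_val i * x \<ge> 0" "sign_val j * y \<ge> 0" "r \<ge> 0" "x\<^sup>2 + y\<^sup>2 = r\<^sup>2"
  shows "\<exists>\<phi>\<in>azimuth_range i j. x = r * cos \<phi> \<and> y = r * sin \<phi>"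
proof (cases "r = 0")
  case True
  then have "x = 0" "y = 0" using assms(4) by (auto simp: sum_power2_eq_zero_iff)
  moreover have "azimuth_range i j \<noteq> {}" by (cases i; cases j) auto
  ultimately show ?thesis using True by auto
next
  case False
  define a b where "a = x / r" and "b = y / r"
  have xy: "x = r * a" "y = r * b" using False by (auto simp: a_def b_def)
  have "r\<^sup>2 * (a\<^sup>2 + b\<^sup>2) = r\<^sup>2 * 1" using assms(4) xy by (simp add: power_mult_distrib algebra_simps)
  then have ab: "a\<^sup>2 + b\<^sup>2 = 1" using False by simp
  have sg: "sign_val i * a \<ge> 0" "sign_val j * b \<ge> 0"
    using assms(1-3) divide_nonneg_nonneg unfolding a_def b_def times_divide_eq_right by blast+
  have "\<exists>\<phi>\<in>azimuth_range i j. a = cos \<phi> \<and> b = sin \<phi>"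
  proof (cases i; cases j)
    assume ij: "i = Pos" "j = Pos"
    obtain t where "0 \<le> t" "t \<le> pi/2" "a = cos t" "b = sin t"
      using sincos_total_pi_half[of a b] sg ab ij by auto
    then show ?thesis using ij by (intro bexI[of _ t]) auto
  next
    assume ij: "i = Neg" "j = Pos"
    obtain t where "0 \<le> t" "t \<le> pi/2" "b = cos t" "- a = sin t"
      using sincos_total_pi_half[of b "- a"] sg ab ij by (auto simp: add.commute)
    then show ?thesis using ij by (intro bexI[of _ "t + pi/2"]) (auto simp: cos_add sin_add)
  next
    assume ij: "i = Neg" "j = Neg"
    obtain t where "0 \<le> t" "t \<le> pi/2" "- a = cos t" "- b = sin t"
      using sincos_total_pi_half[of "- a" "- b"] sg ab ij by auto
    then show ?thesis using ij by (intro bexI[of _ "t + pi"]) (auto simp: cos_add sin_add)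
  next
    assume ij: "i = Pos" "j = Neg"
    obtain t where t: "0 \<le> t" "t \<le> pi/2" "- b = cos t" "a = sin t"
      using sincos_total_pi_half[of "- b" a] sg ab ij by (auto simp: add.commute)
    define q where "q = t + pi/2 + pi"
    have "cos q = - cos (t + pi/2)" "sin q = - sin (t + pi/2)"
      unfolding q_def by (rule cos_periodic_pi, rule sin_periodic_pi)
    then have "a = cos q" "b = sin q" using t by (auto simp: cos_add sin_add)
    moreover have "q \<in> {3*pi/2..2*pi}" using t by (auto simp: q_def)
    ultimately show ?thesis using ij by auto
  qed
  then show ?thesis using xy by auto
qed

lemma azimuth_range_signs:
  assumes "\<phi> \<in> azimuth_range i j"
  shows "sign_val i * cos \<phi> \<ge> 0" "sign_val j * sin \<phi> \<ge> 0"
proof -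
  have pp: "cos t \<ge> 0 \<and> sin t \<ge> 0" if "0 \<le> t" "t \<le> pi/2" for t
    using that by (auto intro: cos_ge_zero sin_ge_zero)
  have "sign_val i * cos \<phi> \<ge> 0 \<and> sign_val j * sin \<phi> \<ge> 0"
    using assms pp[of \<phi>] pp[of "\<phi> - pi/2"] pp[of "\<phi> - pi"] pp[of "2*pi - \<phi>"]
    by (cases i; cases j) (auto simp: cos_diff sin_diff)
  then show "sign_val i * cos \<phi> \<ge> 0" "sign_val j * sin \<phi> \<ge> 0" by auto
qed

lemma Omega_image_quarter_sphere: "Omega ` quarter_sphere i j = quarter_disc i j"
proof (intro equalityI subsetI)
  fix v assume "v \<in> Omega ` quarter_sphere i j"
  then obtain \<mu> \<phi> where mu: "-1 \<le> \<mu>" "\<mu> \<le> 1" and phi: "\<phi> \<in> azimuth_range i j"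
    and v: "v = Omega (sphere_point \<mu> \<phi>)"
    by (auto simp: quarter_sphere_def)
  define s where "s = sqrt (1 - \<mu>\<^sup>2)"
  have "\<mu>\<^sup>2 \<le> 1" using mu by (simp add: abs_square_le_1)
  then have s: "s \<ge> 0" "s\<^sup>2 \<le> 1" by (auto simp: s_def)
  have v12: "v $ 1 = s * cos \<phi>" "v $ 2 = s * sin \<phi>"
    by (simp_all add: v Omega_def sphere_point_def s_def)
  have sq: "(v $ 1)\<^sup>2 + (v $ 2)\<^sup>2 = s\<^sup>2 * ((cos \<phi>)\<^sup>2 + (sin \<phi>)\<^sup>2)"
    by (simp only: v12 power_mult_distrib distrib_left)
  have "sign_val i * v $ 1 = s * (sign_val i * cos \<phi>)"
    "sign_val j * v $ 2 = s * (sign_val j * sin \<phi>)" by (simp_all add: v12)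
  then have "sign_val i * v $ 1 \<ge> 0" "sign_val j * v $ 2 \<ge> 0"
    using mult_nonneg_nonneg[OF s(1)] azimuth_range_signs[OF phi] by (simp_all only:)
  then show "v \<in> quarter_disc i j"
    using s sq by (simp add: quarter_disc_def)
next
  fix v assume v: "v \<in> quarter_disc i j"
  define r where "r = sqrt ((v $ 1)\<^sup>2 + (v $ 2)\<^sup>2)"
  have r: "r \<ge> 0" "(v $ 1)\<^sup>2 + (v $ 2)\<^sup>2 = r\<^sup>2" "r\<^sup>2 \<le> 1"
    using v by (auto simp: r_def quarter_disc_def)
  obtain \<phi> where phi: "\<phi> \<in> azimuth_range i j" "v $ 1 = r * cos \<phi>" "v $ 2 = r * sin \<phi>"
    using azimuth_polar[OF _ _ r(1,2)] v by (auto simp: quarter_disc_def)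
  define \<mu> where "\<mu> = sqrt (1 - r\<^sup>2)"
  have mu: "0 \<le> \<mu>" "\<mu> \<le> 1" "sqrt (1 - \<mu>\<^sup>2) = r" using r by (auto simp: \<mu>_def)
  have "v = Omega (sphere_point \<mu> \<phi>)"
    by (simp add: vec_eq_iff forall_2 Omega_def sphere_point_def mu(3) phi)
  then show "v \<in> Omega ` quarter_sphere i j"
    using mu phi by (force simp: quarter_sphere_def)
qed

end

theory Submission
  imports Defs "HOL-Probability.Giry_Monad"
begin

text \<open>Necessity is convexity: over its total mass, the first moment is an average of points
  \<open>Omega p\<close> of the quarter disc, a closed convex set. In homogeneous form
  (\<open>quarter_disc_cone\<close>) the set is cut out by a norm bound and two sign conditions, and
  each of these survives integration against a non-negative measure (\<open>realizes_imp\<close>).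
  Sufficiency needs one atom only: \<open>Omega\<close> maps the quarter sphere onto the whole
  quarter disc (\<open>Omega_image_quarter_sphere\<close>), so the normalized moment equals
  \<open>Omega p\<close> for some \<open>p\<close>, and the Dirac mass of weight
  \<open>u $ 1\<close> at \<open>p\<close> realizes \<open>u\<close>
  (\<open>scaled_dirac\<close>).\<close>

lemma norm_vec2_power2: "(norm (v :: real^2))\<^sup>2 = (v $ 1)\<^sup>2 + (v $ 2)\<^sup>2"
  by (simp add: norm_vec_def L2_set_def sum_2)

lemma borel_measurable_Omega [measurable]: "Omega \<in> borel_measurable borel"
proof -
  \<comment> \<open>In this form \<open>Omega\<close> is visibly a linear combination of coordinate
    projections, hence continuous.\<close>
  have "Omega = (\<lambda>p. (p $ 1) *\<^sub>R axis 1 1 + (p $ 2) *\<^sub>R axis 2 1)"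
    by (auto simp: fun_eq_iff vec_eq_iff forall_2 Omega_def axis_def)
  moreover have "continuous_on UNIV (\<lambda>p::real^3. (p $ 1) *\<^sub>R (axis 1 1::real^2) + (p $ 2) *\<^sub>R axis 2 1)"
    by (intro continuous_intros)
  ultimately show ?thesis
    using borel_measurable_continuous_onI by metis
qed

lemma finite_measures_onD:
  assumes "M \<in> finite_measures_on S"
  shows "finite_measure M" and "sets M = sets (restrict_space borel S)" and "space M = S"
  using assms sets_eq_imp_space_eq[of M "restrict_space borel S"]
  by (auto simp: finite_measures_on_def space_restrict_space)

text \<open>Clearing the denominator gives conditions that are homogeneous in the pair (mass,
  moment), the shape in which integration delivers them.\<close>

lemma quarter_disc_cone:
  assumes "c > 0"
  shows "(1 / c) *\<^sub>R v \<in> quarter_disc i j \<longleftrightarrow>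
    norm v \<le> c \<and> sign_val i * v $ 1 \<ge> 0 \<and> sign_val j * v $ 2 \<ge> 0"
proof -
  have "((1 / c) *\<^sub>R v) $ 1 ^ 2 + ((1 / c) *\<^sub>R v) $ 2 ^ 2 \<le> 1 \<longleftrightarrow> norm ((1 / c) *\<^sub>R v) \<le> 1"
    unfolding norm_vec2_power2[symmetric] by (simp add: abs_square_le_1)
  also have "\<dots> \<longleftrightarrow> norm v \<le> c"
    using assms by (simp add: field_simps)
  finally show ?thesis
    using assms by (simp add: quarter_disc_def zero_le_divide_iff)
qed

lemma realizes_imp:
  assumes "\<psi> \<in> finite_measures_on (quarter_sphere i j)" and "realizes i j \<psi> u"
  shows "0 \<le> u $ 1" and "norm (first_moment u) \<le> u $ 1"
    and "sign_val i * first_moment u $ 1 \<ge> 0" and "sign_val j * first_moment u $ 2 \<ge> 0"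
proof -
  let ?S = "quarter_sphere i j"
  note \<psi> = finite_measures_onD[OF assms(1)]
  interpret finite_measure \<psi> by (rule \<psi>(1))
  \<comment> \<open>The space of \<open>\<psi>\<close> is the quarter sphere itself, so the
    indicator is 1 throughout.\<close>
  have drop: "(LINT p:?S|\<psi>. f p) = integral\<^sup>L \<psi> f" for f :: "real^3 \<Rightarrow> 'a::{banach, second_countable_topology}"
    unfolding set_lebesgue_integral_def \<psi>(3)[symmetric]
    by (intro Bochner_Integration.integral_cong) auto
  have mass: "u $ 1 = measure \<psi> (space \<psi>)" and mom: "first_moment u = integral\<^sup>L \<psi> Omega"
    using assms(2) by (simp_all add: realizes_def drop)
  show "0 \<le> u $ 1" by (simp add: mass)
  have Om: "Omega p \<in> quarter_disc i j" if "p \<in> space \<psi>" for p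
    using that Omega_image_quarter_sphere[of i j] by (auto simp: \<psi>(3))
  have le1: "norm (Omega p) \<le> 1" if "p \<in> space \<psi>" for p
    using Om[OF that] quarter_disc_cone[of 1 "Omega p" i j] by simp
  have meas: "Omega \<in> borel_measurable \<psi>"
    using measurable_restrict_space1[OF borel_measurable_Omega] measurable_cong_sets[OF \<psi>(2) refl]
    by blast
  \<comment> \<open>A bounded measurable function is integrable for a finite measure.\<close>
  have int: "integrable \<psi> Omega"
    by (rule integrable_const_bound[of _ 1]) (use le1 meas in auto)
  have "norm (integral\<^sup>L \<psi> Omega) \<le> (\<integral>p. norm (Omega p) \<partial>\<psi>)"
    by (rule integral_norm_bound)
  also have "\<dots> \<le> (\<integral>p. 1 \<partial>\<psi>)"
    by (rule integral_mono) (use le1 int in auto)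
  finally show "norm (first_moment u) \<le> u $ 1"
    by (simp add: mom mass)
  \<comment> \<open>Coordinate projections are bounded linear, so they commute with the integral;
    the sign conditions then reduce to pointwise ones.\<close>
  have comp: "integral\<^sup>L \<psi> Omega $ k = (\<integral>p. Omega p $ k \<partial>\<psi>)" for k
    by (rule integral_bounded_linear[OF bounded_linear_vec_nth int, symmetric])
  show "sign_val i * first_moment u $ 1 \<ge> 0" "sign_val j * first_moment u $ 2 \<ge> 0"
    unfolding mom comp integral_mult_right_zero[symmetric]
    by (rule Bochner_Integration.integral_nonneg; use Om in \<open>simp add: quarter_disc_def\<close>)+
qed

text \<open>\<open>M\<close> is \<open>c\<close> times the Dirac measure at \<open>p\<close>, built
  on the trace of the Borel sets on \<open>S\<close>. An atom on the boundary of \<open>S\<close>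
  thus keeps its full mass, provided it lies in \<open>S\<close>.\<close>

lemma scaled_dirac:
  assumes "p \<in> S" and "0 \<le> c"
  defines "M \<equiv> density (return (restrict_space borel S) p) (\<lambda>_. ennreal c)"
  shows "M \<in> finite_measures_on S"
    and "f \<in> borel_measurable borel \<Longrightarrow>
      (LINT q:S|M. f q) = c *\<^sub>R (f p :: 'a :: {banach, second_countable_topology})"
proof -
  let ?R = "restrict_space borel S"
  have p: "p \<in> space ?R"
    using assms(1) by (simp add: space_restrict_space)
  have "emeasure M (space M) = ennreal c * emeasure (return ?R p) (space ?R)"
    unfolding M_def by (subst emeasure_density_const) auto
  also have "\<dots> < \<infinity>"
    using p by simp
  finally show "M \<in> finite_measures_on S"
    by (auto simp: finite_measures_on_def M_def intro!: finite_measureI)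
  assume "f \<in> borel_measurable borel"
  then have f: "f \<in> borel_measurable ?R"
    by (rule measurable_restrict_space1)
  have "(LINT q:S|M. f q) = integral\<^sup>L M f"
    unfolding set_lebesgue_integral_def
    by (intro Bochner_Integration.integral_cong) (auto simp: M_def space_restrict_space)
  also have "\<dots> = (\<integral>q. c *\<^sub>R f q \<partial>return ?R p)"
    unfolding M_def using f assms(2) by (intro integral_density) auto
  also have "\<dots> = c *\<^sub>R f p"
    using f p by (intro integral_return) auto
  finally show "(LINT q:S|M. f q) = c *\<^sub>R f p" .
qed

theorem lemma3p3:
  fixes i j :: qsign and u :: "real^3"
  assumes "u $ 1 \<noteq> 0"
  shows "(\<exists>\<psi> \<in> finite_measures_on (quarter_sphere i j). realizes i j \<psi> u) \<longleftrightarrow>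
         norm (first_moment u) \<le> u $ 1 \<and>
         (1 / u $ 1) *\<^sub>R first_moment u \<in> quarter_disc i j"
proof
  assume "\<exists>\<psi> \<in> finite_measures_on (quarter_sphere i j). realizes i j \<psi> u"
  then obtain \<psi> where "\<psi> \<in> finite_measures_on (quarter_sphere i j)" "realizes i j \<psi> u"
    by blast
  note u = realizes_imp[OF this]
  \<comment> \<open>A total mass is non-negative, so being nonzero makes it positive and division by
    it preserves the inequalities.\<close>
  with assms have "u $ 1 > 0" by simp
  with u show "norm (first_moment u) \<le> u $ 1 \<and>
      (1 / u $ 1) *\<^sub>R first_moment u \<in> quarter_disc i j"
    by (simp add: quarter_disc_cone)
next
  assume R: "norm (first_moment u) \<le> u $ 1 \<and>
      (1 / u $ 1) *\<^sub>R first_moment u \<in> quarter_disc i j"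
  then obtain p where p: "p \<in> quarter_sphere i j" "Omega p = (1 / u $ 1) *\<^sub>R first_moment u"
    by (metis Omega_image_quarter_sphere imageE)
  \<comment> \<open>The norm bound forces this sign, which makes \<open>u $ 1\<close> an admissible
    weight for the atom.\<close>
  have u: "0 \<le> u $ 1"
    using R norm_ge_zero order_trans by blast
  note dirac = scaled_dirac[OF p(1) u]
  have "realizes i j (density (return (restrict_space borel (quarter_sphere i j)) p)
      (\<lambda>_. ennreal (u $ 1))) u"
    using assms by (simp add: realizes_def dirac(2) p(2))
  then show "\<exists>\<psi> \<in> finite_measures_on (quarter_sphere i j). realizes i j \<psi> u"
    using dirac(1) by blast
qed

end
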